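(* For $|q|<1$, $$\sum_{n\ge 0}\sum_{r\ge 0}\frac{q^{n^2+2r^2}}{(q;q^2)_n(q^2;q^2)_r(q;q)_{n-2r}}=\frac{(q^8,q^{10},q^{18};q^{18})_\infty}{(q;q)_\infty}.$$
   Context: $(x;q)_m=\prod_{j=0}^{m-1}(1-xq^j)$, $(x;q)_\infty=\prod_{j=0}^\infty(1-xq^j)$, and $(x_1,\dots,x_p;q)_\infty=(x_1;q)_\infty\cdots(x_p;q)_\infty$. By convention $1/(q;q)_m=0$ for $m<0$, so only terms with $n\ge 2r$ contribute. *)

theory Defs
  imports "HOL-Analysis.Analysis"
begin

definition qpoch :: "complex \<Rightarrow> complex \<Rightarrow> nat \<Rightarrow> complex" where
  "qpoch x q m = (\<Prod>j<m. 1 - x * q ^ j)"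

(* For norm q < 1 the product converges for every x; prodinf also allows finitely many zero factors. *)
definition qpoch_inf :: "complex \<Rightarrow> complex \<Rightarrow> complex" where
  "qpoch_inf x q = (\<Prod>j. 1 - x * q ^ j)"

definition qpoch_infs :: "complex list \<Rightarrow> complex \<Rightarrow> complex" where
  "qpoch_infs xs q = (\<Prod>x\<leftarrow>xs. qpoch_inf x q)"

(* The reciprocal 1 / (q;q)_m for an integer index m, which is 0 by convention when m < 0. *)
definition inv_qfact :: "complex \<Rightarrow> int \<Rightarrow> complex" where
  "inv_qfact q m = (if m < 0 then 0 else 1 / qpoch q q (nat m))"

end

theory Submission
  imports Defs
begin

text \<open>
  The identity is an instance of Bailey's method. A sequence $\beta_n$ and coefficients $\alpha_k$
  form a Bailey pair in base $p$ if
  $\beta_n = \sum_{|k| \le n} \alpha_k / ((p;p)_{n-k} (p;p)_{n+k})$,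
  and a summation of $q$-Vandermonde type turns one such pair into another.

  The inner sum over $r$ uses $1/(q^2;q^2)_r$, which is the $\beta$-sequence of Rogers' pair in base
  $q^2$ with $\alpha_k = (-1)^k q^{3k^2+k}$ (\<open>rogers_bailey_pair\<close>). The weights
  $q^{2r^2}/(q;q)_{n-2r}$ are those of a quadratic change of base, from $q^2$ to $q$
  (\<open>base_change_kernel\<close>): the inner sum divided by $(q;q^2)_n$ is again a $\beta$-sequence, now
  in base $q$, with the coefficient $(-1)^k q^{5k^2+k}$ at index $2k$. A last ordinary Bailey step
  (\<open>bailey_step_kernel\<close>) inserts $q^{n^2}$ and multiplies this coefficient by $q^{4k^2}$. The
  result is the finite identity \<open>truncated_double_sum\<close>, with right-hand side
  $\sum_k (-1)^k q^{9k^2+k} / ((q;q)_{L-2k} (q;q)_{L+2k})$ and with the weight $1/(q;q)_{L-n}$ in the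
  double sum.

  As $L$ tends to infinity both sides converge by dominated convergence, and a factor
  $1/(q;q)_\infty$ cancels, which leaves $\sum_k (-1)^k q^{9k^2+k} / (q;q)_\infty$. This theta
  series is the product $(q^8, q^{10}, q^{18}; q^{18})_\infty$ by Jacobi's triple product
  (\<open>jacobi_triple_product\<close>), itself the limit of a finite identity
  (\<open>finite_jacobi_triple\<close>) which also supplies the unit Bailey pair behind Rogers' pair.

  Keeping everything finite up to the last limit avoids all rearrangements of infinite sums, and the
  convention $1/(q;q)_m = 0$ for $m < 0$ lets every sum be extended or shifted without case
  distinctions.
\<close>

section \<open>Reciprocals of $q$-factorials\<close>

lemma qpow_neq_1:
  fixes q :: complex
  assumes "norm q < 1" "n > 0"
  shows "q ^ n \<noteq> 1"
  by (metis assms norm_one norm_power less_irrefl power_less_one_iff norm_ge_zero power_eq_1_iff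
      zero_less_iff_neq_zero)

lemma norm_power_lt_1:
  fixes q :: complex
  assumes "norm q < 1" "d > 0"
  shows "norm (q ^ d) < 1"
  using assms by (simp add: norm_power power_less_one_iff)

lemma inv_qfact_neg [simp]: "m < 0 \<Longrightarrow> inv_qfact q m = 0"
  by (simp add: inv_qfact_def)

lemma inv_qfact_0 [simp]: "inv_qfact q 0 = 1"
  by (simp add: inv_qfact_def qpoch_def)

lemma qpoch_0 [simp]: "qpoch x q 0 = 1"
  by (simp add: qpoch_def)

lemma qpoch_Suc: "qpoch x q (Suc n) = qpoch x q n * (1 - x * q ^ n)"
  by (simp add: qpoch_def)

lemma inv_qfact_rec:
  assumes "norm q < 1"
  shows "(1 - q ^ nat m) * inv_qfact q m = inv_qfact q (m - 1)"
proof (cases "m \<le> 0")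
  case True
  then show ?thesis by (cases "m = 0") auto
next
  case False
  then obtain n where m: "m = int (Suc n)"
    by (metis not_le zero_less_imp_eq_int gr0_implies_Suc)
  have "q ^ Suc n \<noteq> 1" using qpow_neq_1[OF assms] by blast
  then have "(1 - q * q ^ n) \<noteq> 0" by simp
  moreover have "nat (int (Suc n)) = Suc n" "nat (int (Suc n) - 1) = n" by auto
  ultimately show ?thesis
    unfolding m inv_qfact_def by (simp add: qpoch_Suc)
qed

lemma inv_qfact_rec_nat:
  assumes "norm q < 1"
  shows "(1 - q ^ Suc n) * inv_qfact q (int (Suc n)) = inv_qfact q (int n)"
proof -
  have "nat (int (Suc n)) = Suc n" "int (Suc n) - 1 = int n" by auto
  with inv_qfact_rec[OF assms, of "int (Suc n)"] show ?thesis by metis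
qed

lemma inv_qfact_pair_eq_0:
  assumes "n < \<bar>k\<bar>"
  shows "inv_qfact q (n - k) * inv_qfact q (n + k) = 0"
proof (cases "k \<ge> 0")
  case True
  then have "n - k < 0" using assms by simp
  then show ?thesis by simp
next
  case False
  then have "n + k < 0" using assms by simp
  then show ?thesis by simp
qed

section \<open>Two terminating summations\<close>

text \<open>The two summations needed are the limiting $q$-Chu--Vandermonde sum (\<open>d = 1\<close>) and a
  $q$-Gauss sum in base $q^2$ (\<open>d = 2\<close>). They are kept in one family because both satisfy the
  recurrence below. The index \<open>N\<close> is an integer since the recurrence lowers it by \<open>d\<close>, possibly
  below \<open>0\<close>, and the bound \<open>B\<close> may be any number from \<open>N\<close> on, which lets the recurrence
  shift the summation index freely.\<close>
definition vandermonde_sum :: "nat \<Rightarrow> complex \<Rightarrow> nat \<Rightarrow> int \<Rightarrow> nat \<Rightarrow> complex" where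
  "vandermonde_sum d q B N m =
     (\<Sum>s\<le>B. q ^ (d * s * (s + m)) * inv_qfact q (N - int (d * s)) *
        inv_qfact (q ^ d) (int s) * inv_qfact (q ^ d) (int (s + m)))"

text \<open>Write $1 - q^{N+1} = (1 - q^{N+1-ds}) + q^{N+1-ds}(1 - q^{ds})$ in the summand. The first part
  lowers \<open>N\<close> by one; the second cancels the last factor of $(q^d;q^d)_s$, and the shift
  $s \mapsto s+1$ then turns it into the sum with \<open>N\<close> lowered by \<open>d\<close> and \<open>m\<close> raised by one.\<close>
lemma vandermonde_sum_rec:
  assumes q: "norm q < 1" and d: "d > 0"
  shows "(1 - q ^ Suc N) * vandermonde_sum d q (Suc B) (int (Suc N)) m =
     vandermonde_sum d q (Suc B) (int N) m +
     q ^ (Suc N + d * m) * vandermonde_sum d q B (int (Suc N) - int d) (Suc m)"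
proof -
  define t where "t N m s = q ^ (d * s * (s + m)) * inv_qfact q (N - int (d * s)) *
        inv_qfact (q ^ d) (int s) * inv_qfact (q ^ d) (int (s + m))" for N m s
  define u where "u s = q ^ (d * s * (s + m)) * (q ^ nat (int (Suc N) - int (d * s)) *
        inv_qfact q (int (Suc N) - int (d * s))) *
        ((1 - q ^ (d * s)) * inv_qfact (q ^ d) (int s)) * inv_qfact (q ^ d) (int (s + m))" for s
  note qd = norm_power_lt_1[OF q d]
  have split: "(1 - q ^ Suc N) * t (int (Suc N)) m s = t (int N) m s + u s" for s
  proof (cases "d * s \<le> Suc N")
    case True
    define e where "e = Suc N - d * s"
    have e: "int (Suc N) - int (d * s) = int e" "int N - int (d * s) = int e - 1"
      using True by (auto simp: e_def)
    have "q ^ Suc N = q ^ e * q ^ (d * s)"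
      using True by (simp add: e_def flip: power_add)
    then have "(1 - q ^ Suc N) * inv_qfact q (int e) =
        (1 - q ^ nat (int e)) * inv_qfact q (int e) + q ^ e * (1 - q ^ (d * s)) * inv_qfact q (int e)"
      by (simp add: algebra_simps)
    then have *: "(1 - q ^ Suc N) * inv_qfact q (int e) =
        inv_qfact q (int e - 1) + q ^ e * (1 - q ^ (d * s)) * inv_qfact q (int e)"
      unfolding inv_qfact_rec[OF q] .
    have "(1 - q ^ Suc N) * t (int (Suc N)) m s =
       q ^ (d * s * (s + m)) * ((1 - q ^ Suc N) * inv_qfact q (int e)) *
        inv_qfact (q ^ d) (int s) * inv_qfact (q ^ d) (int (s + m))"
      by (simp only: t_def e mult_ac)
    also have "\<dots> = t (int N) m s + u s"
      unfolding * t_def u_def e by (simp add: algebra_simps)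
    finally show ?thesis .
  next
    case False
    then show ?thesis by (simp add: t_def u_def del: of_nat_Suc of_nat_mult)
  qed
  have u_Suc: "u (Suc s) = q ^ (Suc N + d * m) * t (int (Suc N) - int d) (Suc m) s" for s
  proof (cases "d * Suc s \<le> Suc N")
    case True
    define e where "e = Suc N - d * Suc s"
    have e: "int (Suc N) - int (d * Suc s) = int e" "int (Suc N) - int d - int (d * s) = int e"
      using True by (auto simp: e_def algebra_simps of_nat_diff)
    have N: "Suc N = e + d * Suc s" using True by (simp add: e_def)
    have ex: "d * Suc s * (Suc s + m) + e = Suc N + d * m + d * s * (s + Suc m)"
      unfolding N by (simp add: algebra_simps)
    have pw: "q ^ (d * Suc s * (Suc s + m)) * q ^ e =
        q ^ (Suc N + d * m) * q ^ (d * s * (s + Suc m))"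
      by (simp only: ex flip: power_add)
    have fac: "(1 - q ^ (d * Suc s)) * inv_qfact (q ^ d) (int (Suc s)) = inv_qfact (q ^ d) (int s)"
      using inv_qfact_rec_nat[OF qd, of s] by (simp only: power_mult)
    have sm: "Suc s + m = s + Suc m" by simp
    have "u (Suc s) = (q ^ (d * Suc s * (Suc s + m)) * q ^ e) * inv_qfact q (int e) *
        inv_qfact (q ^ d) (int s) * inv_qfact (q ^ d) (int (s + Suc m))"
      unfolding u_def fac e nat_int by (simp only: mult_ac sm)
    also have "\<dots> = q ^ (Suc N + d * m) * t (int (Suc N) - int d) (Suc m) s"
      unfolding pw t_def e by (simp only: mult_ac)
    finally show ?thesis .
  next
    case False
    then have "int (Suc N) - int (d * Suc s) < 0" "int (Suc N) - int d - int (d * s) < 0"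
      by (simp_all add: algebra_simps flip: of_nat_add of_nat_mult of_nat_Suc)
    then show ?thesis unfolding u_def t_def by (simp only: inv_qfact_neg) simp
  qed
  have "(1 - q ^ Suc N) * vandermonde_sum d q (Suc B) (int (Suc N)) m =
      (\<Sum>s\<le>Suc B. t (int N) m s + u s)"
    unfolding vandermonde_sum_def sum_distrib_left t_def[symmetric] split ..
  also have "\<dots> = (\<Sum>s\<le>Suc B. t (int N) m s) + (\<Sum>s\<le>B. u (Suc s))"
    unfolding sum.distrib sum.atMost_Suc_shift[of u] by (simp add: u_def)
  finally show ?thesis
    by (simp only: u_Suc sum_distrib_left vandermonde_sum_def t_def)
qed

lemma vandermonde_sum_0:
  assumes "d > 0"
  shows "vandermonde_sum d q B 0 m = inv_qfact (q ^ d) (int m)"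
proof -
  have "vandermonde_sum d q B 0 m = (\<Sum>s\<in>{0}. q ^ (d * s * (s + m)) * inv_qfact q (0 - int (d * s)) *
        inv_qfact (q ^ d) (int s) * inv_qfact (q ^ d) (int (s + m)))"
    unfolding vandermonde_sum_def using assms
    by (intro sum.mono_neutral_right) (auto simp del: of_nat_mult)
  then show ?thesis by simp
qed

lemma vandermonde_sum_neg:
  assumes "N < 0"
  shows "vandermonde_sum d q B N m = 0"
  unfolding vandermonde_sum_def
  by (rule sum.neutral) (use assms in \<open>auto simp del: of_nat_mult\<close>)

lemma vandermonde_sum_base_q:
  assumes q: "norm q < 1"
  shows "N \<le> B \<Longrightarrow> vandermonde_sum 1 q B (int N) m = inv_qfact q (int N) * inv_qfact q (int (N + m))"
proof (induction N arbitrary: B m)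
  case 0
  then show ?case by (simp add: vandermonde_sum_0)
next
  case (Suc N)
  obtain B' where B: "B = Suc B'" "N \<le> B'" using Suc.prems by (cases B) auto
  let ?i = "\<lambda>n. inv_qfact q (int n)"
  have nz: "1 - q ^ Suc N \<noteq> 0" using qpow_neq_1[OF q, of "Suc N"] by simp
  have r1: "?i N = (1 - q ^ Suc N) * ?i (Suc N)"
    and r2: "?i (N + m) = (1 - q ^ Suc (N + m)) * ?i (Suc (N + m))"
    using inv_qfact_rec_nat[OF q] by metis+
  have "(1 - q ^ Suc N) * vandermonde_sum 1 q B (int (Suc N)) m =
      ?i N * ?i (N + m) + q ^ (Suc N + m) * (?i N * ?i (N + Suc m))"
    using vandermonde_sum_rec[OF q, of 1 N B' m] Suc.IH[of B' "Suc m"] Suc.IH[of B m] B by simp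
  also have "\<dots> = (1 - q ^ Suc N) * (?i (Suc N) * ?i (Suc N + m))"
    unfolding r1 r2 by (simp add: algebra_simps)
  finally show ?case using nz by simp
qed

text \<open>For \<open>d = 2\<close> the recurrence reduces to the polynomial identity
  $1 - q^{2N+2m-1} = (1 - q^{N+2m}) + q^{N+2m}(1 - q^{N-1})$.\<close>
lemma vandermonde_sum_base_q2:
  assumes q: "norm q < 1"
  shows "N \<le> B \<Longrightarrow> vandermonde_sum 2 q B (int N) m =
      qpoch q (q\<^sup>2) (N + m) * inv_qfact q (int N) * inv_qfact q (int (N + 2 * m))"
proof (induction N arbitrary: B m rule: less_induct)
  case (less N)
  let ?i = "\<lambda>n. inv_qfact q (int n)"
  note r = inv_qfact_rec_nat[OF q]
  show ?case
  proof (cases N)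
    case 0
    have "inv_qfact (q\<^sup>2) (int m) = qpoch q (q\<^sup>2) m * ?i (2 * m)"
    proof (induction m)
      case (Suc m)
      have nz: "1 - (q\<^sup>2) ^ Suc m \<noteq> 0"
        using qpow_neq_1[OF norm_power_lt_1[OF q, of 2], of "Suc m"] by simp
      have "(1 - (q\<^sup>2) ^ Suc m) * inv_qfact (q\<^sup>2) (int (Suc m)) = qpoch q (q\<^sup>2) m * ?i (2 * m)"
        using inv_qfact_rec_nat[OF norm_power_lt_1[OF q, of 2], of m] Suc by simp
      also have "?i (2 * m) = (1 - q ^ Suc (2 * m)) * ((1 - q ^ Suc (Suc (2 * m))) * ?i (Suc (Suc (2 * m))))"
        by (simp only: r)
      also have "Suc (Suc (2 * m)) = 2 * Suc m" by simp
      also have "q ^ (2 * Suc m) = (q\<^sup>2) ^ Suc m" by (rule power_mult)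
      also have "q ^ Suc (2 * m) = q * (q\<^sup>2) ^ m" by (simp flip: power_mult)
      finally have "(1 - (q\<^sup>2) ^ Suc m) * inv_qfact (q\<^sup>2) (int (Suc m)) =
          (1 - (q\<^sup>2) ^ Suc m) * (qpoch q (q\<^sup>2) (Suc m) * ?i (2 * Suc m))"
        by (simp only: qpoch_Suc mult_ac)
      then show ?case using nz by simp
    qed simp
    then show ?thesis using 0 by (simp add: vandermonde_sum_0)
  next
    case (Suc M)
    obtain B' where B: "B = Suc B'" "M \<le> B'" using less.prems Suc by (cases B) auto
    have nz: "1 - q ^ N \<noteq> 0" using qpow_neq_1[OF q, of N] Suc by simp
    define P where "P = qpoch q (q\<^sup>2) (M + m)"
    define I where "I = ?i (N + 2 * m)"
    have r1: "?i M = (1 - q ^ N) * ?i N"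
      using r[of M] Suc by simp
    have r2: "?i (M + 2 * m) = (1 - q ^ (N + 2 * m)) * I"
      using r[of "M + 2 * m"] Suc by (simp add: I_def)
    have P: "qpoch q (q\<^sup>2) (N + m) = P * (1 - q ^ (M + N + 2 * m))"
    proof -
      have "q * (q\<^sup>2) ^ (M + m) = q ^ (M + N + 2 * m)"
        by (simp add: Suc mult_2 flip: power_mult power_Suc)
      then show ?thesis by (simp add: P_def Suc qpoch_Suc)
    qed
    have b1: "vandermonde_sum 2 q B (int M) m = P * ?i M * ?i (M + 2 * m)"
      using less.IH[of M B m] less.prems Suc by (simp add: P_def)
    have b2: "vandermonde_sum 2 q B' (int N - int 2) (Suc m) = P * (1 - q ^ M) * ?i M * I"
    proof (cases M)
      case 0
      then show ?thesis using Suc by (simp add: vandermonde_sum_neg)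
    next
      case (Suc K)
      have eq: "int N - int 2 = int K" using \<open>N = Suc M\<close> Suc by simp
      have "vandermonde_sum 2 q B' (int K) (Suc m) =
          qpoch q (q\<^sup>2) (K + Suc m) * ?i K * ?i (K + 2 * Suc m)"
        using less.IH[of K B' "Suc m"] B Suc \<open>N = Suc M\<close> by simp
      moreover have "?i K = (1 - q ^ M) * ?i M" using r[of K] Suc by simp
      moreover have "K + Suc m = M + m" "K + 2 * Suc m = N + 2 * m"
        using Suc \<open>N = Suc M\<close> by simp_all
      ultimately show ?thesis unfolding eq P_def I_def by (simp only: mult_ac)
    qed
    have "(1 - q ^ N) * vandermonde_sum 2 q B (int N) m =
        P * ?i M * ?i (M + 2 * m) + q ^ (N + 2 * m) * (P * (1 - q ^ M) * ?i M * I)"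
      using vandermonde_sum_rec[OF q, of 2 M B' m] b1 b2 Suc B by (simp only: Suc)
    also have "\<dots> = (1 - q ^ N) * (P * (1 - q ^ (M + N + 2 * m)) * ?i N * I)"
      unfolding r1 r2 by (simp add: algebra_simps power_add)
    finally show ?thesis using nz by (simp add: P I_def)
  qed
qed

text \<open>The kernels of Bailey's lemma are symmetric in \<open>k\<close> and vanish for \<open>r < \<bar>k\<bar>\<close>, so the
  substitution $r = s + |k|$ brings them into the form above with \<open>m = 2 \<bar>k\<bar>\<close>.\<close>
lemma vandermonde_sum_reindex:
  assumes d: "d > 0" and LB: "L \<le> B"
  shows "(\<Sum>r\<le>B. q ^ (d * r\<^sup>2) * inv_qfact q (int L - int (d * r)) *
            (inv_qfact (q ^ d) (int r - k) * inv_qfact (q ^ d) (int r + k))) =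
         q ^ (d * nat (k\<^sup>2)) * vandermonde_sum d q B (int L - int d * \<bar>k\<bar>) (nat (2 * \<bar>k\<bar>))"
proof -
  define m where "m = nat \<bar>k\<bar>"
  have km: "k = int m \<or> k = - int m" by (auto simp: m_def)
  then have k2: "nat (k\<^sup>2) = m\<^sup>2" by (auto simp flip: of_nat_power)
  define t where "t r = q ^ (d * r\<^sup>2) * inv_qfact q (int L - int (d * r)) *
            (inv_qfact (q ^ d) (int r - int m) * inv_qfact (q ^ d) (int r + int m))" for r
  have big: "t r = 0" if "r > B" for r
  proof -
    have "r \<le> d * r" using d by simp
    then have "L < d * r" using that LB by linarith
    then have "int L - int (d * r) < 0" by (simp del: of_nat_mult)
    then show ?thesis by (simp only: t_def inv_qfact_neg) simp
  qed
  have "(\<Sum>r\<le>B. q ^ (d * r\<^sup>2) * inv_qfact q (int L - int (d * r)) *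
            (inv_qfact (q ^ d) (int r - k) * inv_qfact (q ^ d) (int r + k))) = (\<Sum>r\<le>B. t r)"
    using km by (auto simp: t_def mult_ac)
  also have "\<dots> = (\<Sum>r\<le>B + m. t r)"
    by (intro sum.mono_neutral_left) (auto simp: big)
  also have "\<dots> = (\<Sum>r\<in>{m..B + m}. t r)"
    by (intro sum.mono_neutral_right) (auto simp: t_def)
  also have "\<dots> = (\<Sum>s\<le>B. t (s + m))"
    by (rule sum.reindex_bij_witness[of _ "\<lambda>s. s + m" "\<lambda>r. r - m"]) auto
  also have "\<dots> = (\<Sum>s\<le>B. q ^ (d * m\<^sup>2) * (q ^ (d * s * (s + 2 * m)) *
      inv_qfact q (int L - int d * \<bar>k\<bar> - int (d * s)) *
        inv_qfact (q ^ d) (int s) * inv_qfact (q ^ d) (int (s + 2 * m))))"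
  proof (intro sum.cong refl)
    fix s
    have e: "d * (s + m)\<^sup>2 = d * m\<^sup>2 + d * s * (s + 2 * m)"
      by (simp add: power2_eq_square algebra_simps)
    have i: "int L - int (d * (s + m)) = int L - int d * \<bar>k\<bar> - int (d * s)"
      "int (s + m) - int m = int s" "int (s + m) + int m = int (s + 2 * m)"
      by (auto simp: m_def algebra_simps)
    show "t (s + m) = q ^ (d * m\<^sup>2) * (q ^ (d * s * (s + 2 * m)) *
      inv_qfact q (int L - int d * \<bar>k\<bar> - int (d * s)) *
        inv_qfact (q ^ d) (int s) * inv_qfact (q ^ d) (int (s + 2 * m)))"
      unfolding t_def e i power_add by (simp only: mult_ac)
  qed
  also have "\<dots> = q ^ (d * m\<^sup>2) * vandermonde_sum d q B (int L - int d * \<bar>k\<bar>) (2 * m)"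
    by (simp only: vandermonde_sum_def sum_distrib_left)
  also have "2 * m = nat (2 * \<bar>k\<bar>)" by (simp add: m_def nat_mult_distrib)
  finally show ?thesis by (simp only: k2)
qed

text \<open>Bailey's lemma with \<open>a = 1\<close> and both free parameters sent to infinity: the weights
  $q^{r^2}/(q;q)_{L-r}$ multiply the coefficient of index \<open>k\<close> by $q^{k^2}$.\<close>
lemma bailey_step_kernel:
  assumes q: "norm q < 1"
  shows "(\<Sum>r\<le>L. q ^ r\<^sup>2 * inv_qfact q (int L - int r) *
            (inv_qfact q (int r - k) * inv_qfact q (int r + k))) =
         q ^ nat (k\<^sup>2) * (inv_qfact q (int L - k) * inv_qfact q (int L + k))"
proof -
  have "vandermonde_sum 1 q L (int L - \<bar>k\<bar>) (nat (2 * \<bar>k\<bar>)) =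
      inv_qfact q (int L - k) * inv_qfact q (int L + k)"
  proof (cases "\<bar>k\<bar> \<le> int L")
    case True
    define N where "N = nat (int L - \<bar>k\<bar>)"
    have N: "int L - \<bar>k\<bar> = int N" "N \<le> L" using True by (auto simp: N_def)
    have N': "int (N + nat (2 * \<bar>k\<bar>)) = int L + \<bar>k\<bar>" using True by (simp add: N_def)
    show ?thesis
      unfolding N(1) vandermonde_sum_base_q[OF q N(2)] N' unfolding N(1)[symmetric]
      by (cases "k \<ge> 0") simp_all
  next
    case False
    then show ?thesis
      using inv_qfact_pair_eq_0[of "int L" k q] by (simp add: vandermonde_sum_neg)
  qed
  then show ?thesis
    using vandermonde_sum_reindex[of 1 L L q k] by simp
qed

text \<open>The weights $q^{2r^2}/(q;q)_{n-2r}$ carry a Bailey pair in base $q^2$ to one in base $q$, moving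
  the coefficient of index \<open>k\<close> to index \<open>2k\<close>. The price is the factor $(q;q^2)_n$, exactly
  the one that the double sum divides by.\<close>
lemma base_change_kernel:
  assumes q: "norm q < 1"
  shows "(\<Sum>r\<le>L. q ^ (2 * r\<^sup>2) * inv_qfact q (int L - 2 * int r) *
            (inv_qfact (q\<^sup>2) (int r - k) * inv_qfact (q\<^sup>2) (int r + k))) =
         q ^ (2 * nat (k\<^sup>2)) *
           (qpoch q (q\<^sup>2) L * (inv_qfact q (int L - 2 * k) * inv_qfact q (int L + 2 * k)))"
proof -
  have "vandermonde_sum 2 q L (int L - 2 * \<bar>k\<bar>) (nat (2 * \<bar>k\<bar>)) =
      qpoch q (q\<^sup>2) L * (inv_qfact q (int L - 2 * k) * inv_qfact q (int L + 2 * k))"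
  proof (cases "2 * \<bar>k\<bar> \<le> int L")
    case True
    define N where "N = nat (int L - 2 * \<bar>k\<bar>)"
    have N: "int L - 2 * \<bar>k\<bar> = int N" "N \<le> L" using True by (auto simp: N_def)
    have N': "int (N + 2 * nat (2 * \<bar>k\<bar>)) = int L + 2 * \<bar>k\<bar>" "N + nat (2 * \<bar>k\<bar>) = L"
      using True by (auto simp: N_def)
    show ?thesis
      unfolding N(1) vandermonde_sum_base_q2[OF q N(2)] N' unfolding N(1)[symmetric]
      by (cases "k \<ge> 0") simp_all
  next
    case False
    then show ?thesis
      using inv_qfact_pair_eq_0[of "int L" "2 * k" q] by (simp add: vandermonde_sum_neg)
  qed
  then show ?thesis
    using vandermonde_sum_reindex[of 2 L L q k] by simp
qed

section \<open>The finite triple product\<close>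

definition tri :: "int \<Rightarrow> nat" where
  "tri k = nat (k * (k + 1) div 2)"

text \<open>The general term of Ramanujan's $f(-a,-b) = \sum_k (-1)^k a^{k(k+1)/2} b^{k(k-1)/2}$. With the two
  arguments \<open>a\<close>, \<open>b\<close> in place of $z$ and $Q/z$ all exponents are natural numbers and nothing
  is divided by, so \<open>q = 0\<close> needs no separate treatment.\<close>
definition theta_term :: "complex \<Rightarrow> complex \<Rightarrow> int \<Rightarrow> complex" where
  "theta_term a b k = (-1) ^ nat \<bar>k\<bar> * a ^ tri k * b ^ tri (k - 1)"

lemma tri_eq: "2 * int (tri k) = k * (k + 1)"
proof -
  have "k * (k + 1) \<ge> 0" by (cases "k \<ge> 0") (auto simp: zero_le_mult_iff)
  moreover have "even (k * (k + 1))" by simp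
  ultimately show ?thesis unfolding tri_def by simp
qed

lemma theta_term_minus: "theta_term a b (- k) = theta_term b a k"
proof -
  have "2 * int (tri (- k)) = 2 * int (tri (k - 1))" "2 * int (tri (- k - 1)) = 2 * int (tri k)"
    unfolding tri_eq by (simp_all add: algebra_simps)
  then have "tri (- k) = tri (k - 1)" "tri (- k - 1) = tri k" by simp_all
  then show ?thesis by (simp add: theta_term_def)
qed

text \<open>Multiplication by \<open>a\<close> moves the theta coefficients one step up, at the cost of a power of
  \<open>Q = a b\<close>; the factor $Q^L$ keeps that power nonnegative. The step down by \<open>b\<close> follows by
  the symmetry of the preceding lemma.\<close>
lemma theta_term_shift:
  assumes "j \<le> int L"
  shows "a * (a * b) ^ L * theta_term a b j = - ((a * b) ^ nat (int L - j) * theta_term a b (j + 1))"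
proof -
  have s: "(-1) ^ nat \<bar>j + 1\<bar> = - ((-1) ^ nat \<bar>j\<bar> :: complex)"
  proof (cases "j \<ge> 0")
    case True
    then have "nat \<bar>j + 1\<bar> = Suc (nat \<bar>j\<bar>)" by simp
    then show ?thesis by (simp only:) simp
  next
    case False
    then have "nat \<bar>j\<bar> = Suc (nat \<bar>j + 1\<bar>)" by simp
    then show ?thesis by (simp only:) simp
  qed
  define N where "N = nat (int L - j)"
  have "int N = int L - j" using assms by (simp add: N_def)
  then have "2 * int (Suc L + tri j) = 2 * int (N + tri (j + 1))"
    "2 * int (L + tri (j - 1)) = 2 * int (N + tri j)"
    using tri_eq[of j] tri_eq[of "j - 1"] tri_eq[of "j + 1"] by (simp_all add: algebra_simps)
  then have e: "Suc L + tri j = N + tri (j + 1)" "L + tri (j - 1) = N + tri j"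
    by (simp_all del: of_nat_add of_nat_Suc add_Suc)
  have "a * (a * b) ^ L * theta_term a b j =
      (-1) ^ nat \<bar>j\<bar> * a ^ (Suc L + tri j) * b ^ (L + tri (j - 1))"
    by (simp add: theta_term_def power_add power_mult_distrib)
  also have "\<dots> = - ((a * b) ^ nat (int L - j) * theta_term a b (j + 1))"
    unfolding e N_def[symmetric] by (simp add: theta_term_def power_add power_mult_distrib s)
  finally show ?thesis .
qed

text \<open>A Pascal-type rule, in two steps at once, for the central Gaussian binomial coefficients. With
  $x = Q^{L+1-k}$ and $y = Q^{L+1+k}$ it is the identity
  $(1 - xy)(1 - xy/Q) = (1 + xy/Q)(1-x)(1-y) + x(1-y)(1-y/Q) + y(1-x)(1-x/Q)$.\<close>
lemma bilateral_kernel_rec: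
  assumes Q: "norm Q < 1" and k: "\<bar>k\<bar> \<le> int L + 1"
  defines "g \<equiv> (\<lambda>n k. inv_qfact Q (n - k) * inv_qfact Q (n + k))"
  shows "(1 - Q ^ (2 * L + 1)) * (1 - Q ^ (2 * L + 2)) * g (int L + 1) k =
     (1 + Q ^ (2 * L + 1)) * g (int L) k + Q ^ nat (int L + 1 - k) * g (int L) (k - 1)
       + Q ^ nat (int L + 1 + k) * g (int L) (k + 1)"
proof -
  define u v where "u = nat (int L + 1 - k)" and "v = nat (int L + 1 + k)"
  define X Y where "X = inv_qfact Q (int u)" and "Y = inv_qfact Q (int v)"
  note rec = inv_qfact_rec[OF Q]
  have uv: "int L + 1 - k = int u" "int L + 1 + k = int v" "u + v = 2 * L + 2"
    using k by (auto simp: u_def v_def)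
  have i: "int u - 1 = int L - k" "int v - 1 = int L + k"
    "int L - (k + 1) = int L - k - 1" "int L + (k - 1) = int L + k - 1"
    "nat (int L - k) = u - 1" "nat (int L + k) = v - 1"
    using uv by linarith+
  have X1: "inv_qfact Q (int L - k) = (1 - Q ^ u) * X"
    using rec[of "int u"] by (simp only: X_def i nat_int)
  have Y1: "inv_qfact Q (int L + k) = (1 - Q ^ v) * Y"
    using rec[of "int v"] by (simp only: Y_def i nat_int)
  have X2: "inv_qfact Q (int L - (k + 1)) = (1 - Q ^ (u - 1)) * ((1 - Q ^ u) * X)"
    using rec[of "int L - k"] by (simp only: X1 i)
  have Y2: "inv_qfact Q (int L + (k - 1)) = (1 - Q ^ (v - 1)) * ((1 - Q ^ v) * Y)"
    using rec[of "int L + k"] by (simp only: Y1 i)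
  have X3: "inv_qfact Q (int L - (k - 1)) = X" "inv_qfact Q (int L + (k + 1)) = Y"
    using uv by (simp_all only: X_def Y_def diff_diff_eq2 add.assoc[symmetric])
      (simp_all add: add_ac)
  have "(1 - Q ^ (2 * L + 1)) * (1 - Q ^ (2 * L + 2)) =
      (1 + Q ^ (2 * L + 1)) * ((1 - Q ^ u) * (1 - Q ^ v)) +
      Q ^ u * ((1 - Q ^ (v - 1)) * (1 - Q ^ v)) + Q ^ v * ((1 - Q ^ (u - 1)) * (1 - Q ^ u))"
  proof (cases u)
    case 0
    then have "v = 2 * L + 2" using uv by simp
    then show ?thesis using 0 by simp
  next
    case (Suc u')
    show ?thesis
    proof (cases v)
      case 0
      then have "u = 2 * L + 2" using uv by simp
      then show ?thesis using 0 by simp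
    next
      case (Suc v')
      have L: "2 * L + 1 = Suc (u' + v')" "2 * L + 2 = Suc (Suc (u' + v'))"
        using uv Suc \<open>u = Suc u'\<close> by simp_all
      show ?thesis
        unfolding L Suc \<open>u = Suc u'\<close> by (simp add: power_add) (simp add: algebra_simps)
    qed
  qed
  note poly = this
  show ?thesis
    unfolding g_def X1 X2 X3 Y1 Y2 uv(1,2) nat_int X_def[symmetric] Y_def[symmetric] poly
    by (simp only: algebra_simps)
qed

text \<open>The finite form of the triple product. By the rule above and the shift of the theta coefficients,
  passing from \<open>L\<close> to \<open>L + 1\<close> multiplies the sum by
  $(1 + Q^{2L+1} - aQ^L - bQ^L) = (1 - aQ^L)(1 - bQ^L)$, up to the normalising factors.\<close>
lemma finite_jacobi_triple:
  assumes Q: "norm (a * b) < 1"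
  shows "(\<Sum>k\<in>{- int L..int L}. theta_term a b k *
           (inv_qfact (a * b) (int L - k) * inv_qfact (a * b) (int L + k))) =
         qpoch a (a * b) L * qpoch b (a * b) L * inv_qfact (a * b) (2 * int L)"
proof (induction L)
  case 0
  then show ?case by (simp add: theta_term_def tri_def)
next
  case (Suc L)
  define Q where "Q = a * b"
  have Q1: "norm Q < 1" using Q by (simp add: Q_def)
  define g where "g n k = inv_qfact Q (n - k) * inv_qfact Q (n + k)" for n k
  define c where "c = theta_term a b"
  define S where "S = (\<Sum>k\<in>{- int L..int L}. c k * g (int L) k)"
  \<comment> \<open>The factor by which $1/(Q;Q)_{2L}$ and $1/(Q;Q)_{2L+2}$ differ; induction multiplies through by it.\<close>
  define D where "D = (1 - Q ^ (2 * L + 1)) * (1 - Q ^ (2 * L + 2))"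
  let ?I = "{- int (Suc L)..int (Suc L)}"
  have g0: "g (int L) k = 0" if "\<bar>k\<bar> > int L" for k
    using inv_qfact_pair_eq_0[OF that] by (simp add: g_def)
  have S0: "(\<Sum>k\<in>?I. c k * g (int L) k) = S"
    unfolding S_def by (intro sum.mono_neutral_right) (auto intro!: g0)
  have S1: "(\<Sum>k\<in>?I. c k * (Q ^ nat (int L + 1 - k) * g (int L) (k - 1))) = - (a * Q ^ L * S)"
  proof -
    have "(\<Sum>k\<in>?I. c k * (Q ^ nat (int L + 1 - k) * g (int L) (k - 1))) =
        (\<Sum>k\<in>{1 - int L..1 + int L}. c k * (Q ^ nat (int L + 1 - k) * g (int L) (k - 1)))"
      by (intro sum.mono_neutral_right) (auto intro!: g0)
    also have "\<dots> = (\<Sum>j\<in>{- int L..int L}. c (j + 1) * (Q ^ nat (int L - j) * g (int L) j))"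
      by (rule sum.reindex_bij_witness[of _ "\<lambda>j. j + 1" "\<lambda>k. k - 1"]) (auto simp: algebra_simps)
    also have "\<dots> = (\<Sum>j\<in>{- int L..int L}. - (a * Q ^ L * (c j * g (int L) j)))"
    proof (intro sum.cong refl)
      fix j assume "j \<in> {- int L..int L}"
      then have "a * Q ^ L * c j = - (Q ^ nat (int L - j) * c (j + 1))"
        unfolding Q_def c_def by (intro theta_term_shift) auto
      then have *: "Q ^ nat (int L - j) * c (j + 1) = - (a * Q ^ L * c j)" by simp
      have "c (j + 1) * (Q ^ nat (int L - j) * g (int L) j) =
          (Q ^ nat (int L - j) * c (j + 1)) * g (int L) j"
        by (simp only: mult_ac)
      then show "c (j + 1) * (Q ^ nat (int L - j) * g (int L) j) = - (a * Q ^ L * (c j * g (int L) j))"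
        unfolding * by simp
    qed
    finally show ?thesis by (simp add: S_def sum_negf sum_distrib_left)
  qed
  have S2: "(\<Sum>k\<in>?I. c k * (Q ^ nat (int L + 1 + k) * g (int L) (k + 1))) = - (b * Q ^ L * S)"
  proof -
    have "(\<Sum>k\<in>?I. c k * (Q ^ nat (int L + 1 + k) * g (int L) (k + 1))) =
        (\<Sum>k\<in>{- int L - 1..int L - 1}. c k * (Q ^ nat (int L + 1 + k) * g (int L) (k + 1)))"
      by (intro sum.mono_neutral_right) (auto intro!: g0)
    also have "\<dots> = (\<Sum>j\<in>{- int L..int L}. c (j - 1) * (Q ^ nat (int L + j) * g (int L) j))"
      by (rule sum.reindex_bij_witness[of _ "\<lambda>j. j - 1" "\<lambda>k. k + 1"]) (auto simp: algebra_simps)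
    also have "\<dots> = (\<Sum>j\<in>{- int L..int L}. - (b * Q ^ L * (c j * g (int L) j)))"
    proof (intro sum.cong refl)
      fix j assume "j \<in> {- int L..int L}"
      then have "b * (b * a) ^ L * theta_term b a (- j) =
          - ((b * a) ^ nat (int L - (- j)) * theta_term b a (- j + 1))"
        by (intro theta_term_shift) auto
      moreover have "theta_term b a (- j + 1) = c (j - 1)"
        using theta_term_minus[of b a "j - 1"] by (simp add: c_def)
      ultimately have *: "Q ^ nat (int L + j) * c (j - 1) = - (b * Q ^ L * c j)"
        by (simp add: theta_term_minus c_def Q_def mult.commute)
      have "c (j - 1) * (Q ^ nat (int L + j) * g (int L) j) =
          (Q ^ nat (int L + j) * c (j - 1)) * g (int L) j"
        by (simp only: mult_ac)
      then show "c (j - 1) * (Q ^ nat (int L + j) * g (int L) j) = - (b * Q ^ L * (c j * g (int L) j))"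
        unfolding * by simp
    qed
    finally show ?thesis by (simp add: S_def sum_negf sum_distrib_left)
  qed
  have "D * (\<Sum>k\<in>?I. c k * g (int (Suc L)) k) = (\<Sum>k\<in>?I. (1 + Q ^ (2 * L + 1)) * (c k * g (int L) k)
      + c k * (Q ^ nat (int L + 1 - k) * g (int L) (k - 1))
      + c k * (Q ^ nat (int L + 1 + k) * g (int L) (k + 1)))"
    unfolding sum_distrib_left
  proof (intro sum.cong refl)
    fix k assume "k \<in> ?I"
    then have "\<bar>k\<bar> \<le> int L + 1" by auto
    note rec = bilateral_kernel_rec[OF Q1 this, folded g_def D_def]
    have "D * (c k * g (int (Suc L)) k) = c k * (D * g (int L + 1) k)"
      by (simp add: add.commute)
    then show "D * (c k * g (int (Suc L)) k) = (1 + Q ^ (2 * L + 1)) * (c k * g (int L) k)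
      + c k * (Q ^ nat (int L + 1 - k) * g (int L) (k - 1))
      + c k * (Q ^ nat (int L + 1 + k) * g (int L) (k + 1))"
      unfolding rec by (simp only: distrib_left mult.left_commute[of "c k" "1 + Q ^ (2 * L + 1)"])
  qed
  also have "\<dots> = (1 + Q ^ (2 * L + 1)) * S - a * Q ^ L * S - b * Q ^ L * S"
    by (simp only: sum.distrib S1 S2 S0 flip: sum_distrib_left) simp
  also have "\<dots> = (1 - a * Q ^ L) * (1 - b * Q ^ L) * S"
  proof -
    have "Q ^ (2 * L + 1) = a * Q ^ L * (b * Q ^ L)"
      by (simp add: Q_def mult_2 power_add)
    then show ?thesis by (simp add: algebra_simps)
  qed
  also have "S = qpoch a Q L * qpoch b Q L * inv_qfact Q (int (2 * L))"
    using Suc.IH by (simp add: S_def c_def g_def Q_def)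
  also have "inv_qfact Q (int (2 * L)) = D * inv_qfact Q (int (2 * L + 2))"
    using inv_qfact_rec_nat[OF Q1, of "2 * L"] inv_qfact_rec_nat[OF Q1, of "2 * L + 1"]
    by (simp add: D_def mult.assoc)
  finally have "D * (\<Sum>k\<in>?I. c k * g (int (Suc L)) k) =
      D * (qpoch a Q (Suc L) * qpoch b Q (Suc L) * inv_qfact Q (int (2 * L + 2)))"
    by (simp only: qpoch_Suc mult_ac)
  moreover have "D \<noteq> 0"
    using qpow_neq_1[OF Q1, of "2 * L + 1"] qpow_neq_1[OF Q1, of "2 * L + 2"] by (simp add: D_def)
  ultimately have "(\<Sum>k\<in>?I. c k * g (int (Suc L)) k) =
      qpoch a Q (Suc L) * qpoch b Q (Suc L) * inv_qfact Q (int (2 * L + 2))" by simp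
  moreover have "int (2 * L + 2) = 2 * int (Suc L)" by simp
  ultimately show ?case unfolding c_def g_def Q_def by metis
qed

section \<open>Bailey pairs and the truncated identity\<close>

text \<open>The formal content of Bailey's lemma: only an interchange of finite sums. The parameter \<open>c\<close>
  allows coefficients supported on multiples of \<open>c\<close>, as they are after the change of base.\<close>
lemma bailey_transfer:
  fixes \<alpha> :: "int \<Rightarrow> complex"
  assumes c: "c > 0"
    and kernel: "\<And>k. (\<Sum>r\<le>n. w r * (inv_qfact p (int r - k) * inv_qfact p (int r + k))) = v k"
    and \<beta>: "\<And>r. \<beta> r = (\<Sum>k\<in>{- int r..int r}.
               \<alpha> k * (inv_qfact p (int r - c * k) * inv_qfact p (int r + c * k)))"
  shows "(\<Sum>r\<le>n. w r * \<beta> r) = (\<Sum>k\<in>{- int n..int n}. \<alpha> k * v (c * k))"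
proof -
  have "\<beta> r = (\<Sum>k\<in>{- int n..int n}.
      \<alpha> k * (inv_qfact p (int r - c * k) * inv_qfact p (int r + c * k)))" if "r \<le> n" for r
    unfolding \<beta>
  proof (rule sum.mono_neutral_left)
    have "inv_qfact p (int r - c * k) * inv_qfact p (int r + c * k) = 0" if "int r < \<bar>k\<bar>" for k
    proof (rule inv_qfact_pair_eq_0)
      have "1 * \<bar>k\<bar> \<le> c * \<bar>k\<bar>" using c by (intro mult_right_mono) auto
      then show "int r < \<bar>c * k\<bar>" using that c by (simp add: abs_mult)
    qed
    then show "\<forall>k\<in>{- int n..int n} - {- int r..int r}.
        \<alpha> k * (inv_qfact p (int r - c * k) * inv_qfact p (int r + c * k)) = 0"
      by force
  qed (use that in auto)
  then have "(\<Sum>r\<le>n. w r * \<beta> r) = (\<Sum>r\<le>n. \<Sum>k\<in>{- int n..int n}.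
      \<alpha> k * (w r * (inv_qfact p (int r - c * k) * inv_qfact p (int r + c * k))))"
    by (simp add: sum_distrib_left mult_ac)
  also have "\<dots> = (\<Sum>k\<in>{- int n..int n}. \<Sum>r\<le>n.
      \<alpha> k * (w r * (inv_qfact p (int r - c * k) * inv_qfact p (int r + c * k))))"
    by (rule sum.swap)
  also have "\<dots> = (\<Sum>k\<in>{- int n..int n}. \<alpha> k * v (c * k))"
    by (simp only: kernel flip: sum_distrib_left)
  finally show ?thesis .
qed

text \<open>At \<open>a = p\<close>, \<open>b = 1\<close> the finite triple product contains the factor $1 - 1$ and collapses to
  the unit Bailey pair, whose sums vanish except for \<open>r = 0\<close>. One Bailey step applied to it gives
  this pair, from which the Rogers--Ramanujan identities are usually derived.\<close>
lemma rogers_bailey_pair: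
  assumes p: "norm p < 1"
  shows "inv_qfact p (int n) = (\<Sum>k\<in>{- int n..int n}.
     p ^ nat (k\<^sup>2) * theta_term p 1 k * (inv_qfact p (int n - k) * inv_qfact p (int n + k)))"
proof -
  define \<beta> where "\<beta> r = (if r = 0 then 1 else 0 :: complex)" for r :: nat
  have \<beta>: "\<beta> r = (\<Sum>k\<in>{- int r..int r}.
      theta_term p 1 k * (inv_qfact p (int r - 1 * k) * inv_qfact p (int r + 1 * k)))" for r
  proof -
    have "qpoch 1 p r = 0" if "r > 0"
      using that by (auto simp: qpoch_def prod_zero_iff intro!: bexI[of _ 0])
    then show ?thesis
      using finite_jacobi_triple[of p 1 r] p by (auto simp: \<beta>_def)
  qed
  have "inv_qfact p (int n) = (\<Sum>r\<in>{0}. p ^ r\<^sup>2 * inv_qfact p (int n - int r) * \<beta> r)"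
    by (simp add: \<beta>_def)
  also have "\<dots> = (\<Sum>r\<le>n. p ^ r\<^sup>2 * inv_qfact p (int n - int r) * \<beta> r)"
    by (intro sum.mono_neutral_left) (auto simp: \<beta>_def)
  also have "\<dots> = (\<Sum>k\<in>{- int n..int n}. theta_term p 1 k *
      (p ^ nat ((1 * k)\<^sup>2) * (inv_qfact p (int n - 1 * k) * inv_qfact p (int n + 1 * k))))"
    by (rule bailey_transfer[OF _ bailey_step_kernel[OF p] \<beta>]) simp
  finally show ?thesis by (simp add: mult_ac)
qed

lemma inner_sum_bilateral:
  assumes q: "norm q < 1"
  shows "(\<Sum>r\<le>n. q ^ (2 * r\<^sup>2) * inv_qfact q (int n - 2 * int r) * inv_qfact (q\<^sup>2) (int r)) =
     qpoch q (q\<^sup>2) n * (\<Sum>k\<in>{- int n..int n}. q ^ (4 * nat (k\<^sup>2)) * theta_term (q\<^sup>2) 1 k *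
        (inv_qfact q (int n - 2 * k) * inv_qfact q (int n + 2 * k)))"
proof -
  have p: "norm (q\<^sup>2) < 1" using norm_power_lt_1[OF q, of 2] by simp
  have \<beta>: "inv_qfact (q\<^sup>2) (int r) = (\<Sum>k\<in>{- int r..int r}. (q\<^sup>2) ^ nat (k\<^sup>2) * theta_term (q\<^sup>2) 1 k *
     (inv_qfact (q\<^sup>2) (int r - 1 * k) * inv_qfact (q\<^sup>2) (int r + 1 * k)))" for r
    using rogers_bailey_pair[OF p, of r] by simp
  have e: "(q\<^sup>2) ^ i = q ^ (2 * i)" "q ^ (4 * i) = q ^ (2 * i) * q ^ (2 * i)" for i
    by (simp_all flip: power_mult power_add)
  show ?thesis
    by (subst bailey_transfer[OF _ base_change_kernel[OF q] \<beta>])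
      (auto simp: sum_distrib_left e mult_ac)
qed

text \<open>The double sum truncated by the weight $1/(q;q)_{L-n}$: the exponents collected on the way are
  $3k^2+k$ from Rogers' pair in base $q^2$, $2k^2$ from the change of base and $(2k)^2$ from the
  last Bailey step, in total $9k^2+k$.\<close>
lemma truncated_double_sum:
  assumes q: "norm q < 1"
  shows "(\<Sum>n\<le>L. \<Sum>r\<le>n. q ^ (n\<^sup>2 + 2 * r\<^sup>2) / (qpoch q (q\<^sup>2) n * qpoch (q\<^sup>2) (q\<^sup>2) r)
            * inv_qfact q (int n - 2 * int r) * inv_qfact q (int L - int n)) =
     (\<Sum>k\<in>{- int L..int L}. theta_term (q ^ 10) (q ^ 8) k *
        (inv_qfact q (int L - 2 * k) * inv_qfact q (int L + 2 * k)))"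
proof -
  define \<alpha> where "\<alpha> k = q ^ (4 * nat (k\<^sup>2)) * theta_term (q\<^sup>2) 1 k" for k
  define \<beta> where "\<beta> n = (\<Sum>k\<in>{- int n..int n}. \<alpha> k *
        (inv_qfact q (int n - 2 * k) * inv_qfact q (int n + 2 * k)))" for n
  have nz: "qpoch q (q\<^sup>2) n \<noteq> 0" for n
  proof -
    have "1 - q * (q\<^sup>2) ^ j \<noteq> 0" for j
      using qpow_neq_1[OF q, of "Suc (2 * j)"] by (simp add: power_mult)
    then show ?thesis unfolding qpoch_def by (simp only: prod_zero_iff finite_lessThan) blast
  qed
  have "(\<Sum>r\<le>n. q ^ (n\<^sup>2 + 2 * r\<^sup>2) / (qpoch q (q\<^sup>2) n * qpoch (q\<^sup>2) (q\<^sup>2) r)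
            * inv_qfact q (int n - 2 * int r) * inv_qfact q (int L - int n)) =
        q ^ n\<^sup>2 * inv_qfact q (int L - int n) * \<beta> n" for n
  proof -
    have "(\<Sum>r\<le>n. q ^ (n\<^sup>2 + 2 * r\<^sup>2) / (qpoch q (q\<^sup>2) n * qpoch (q\<^sup>2) (q\<^sup>2) r)
            * inv_qfact q (int n - 2 * int r) * inv_qfact q (int L - int n)) =
        q ^ n\<^sup>2 * inv_qfact q (int L - int n) / qpoch q (q\<^sup>2) n *
        (\<Sum>r\<le>n. q ^ (2 * r\<^sup>2) * inv_qfact q (int n - 2 * int r) * inv_qfact (q\<^sup>2) (int r))"
      unfolding sum_distrib_left
      by (intro sum.cong refl) (simp add: inv_qfact_def[of "q\<^sup>2"] power_add)
    also have "(\<Sum>r\<le>n. q ^ (2 * r\<^sup>2) * inv_qfact q (int n - 2 * int r) * inv_qfact (q\<^sup>2) (int r)) =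
        qpoch q (q\<^sup>2) n * \<beta> n"
      using inner_sum_bilateral[OF q] by (simp add: \<beta>_def \<alpha>_def)
    finally show ?thesis using nz by simp
  qed
  then have "(\<Sum>n\<le>L. \<Sum>r\<le>n. q ^ (n\<^sup>2 + 2 * r\<^sup>2) / (qpoch q (q\<^sup>2) n * qpoch (q\<^sup>2) (q\<^sup>2) r)
            * inv_qfact q (int n - 2 * int r) * inv_qfact q (int L - int n)) =
        (\<Sum>n\<le>L. q ^ n\<^sup>2 * inv_qfact q (int L - int n) * \<beta> n)" by simp
  also have "\<dots> = (\<Sum>k\<in>{- int L..int L}. \<alpha> k *
      (q ^ nat ((2 * k)\<^sup>2) * (inv_qfact q (int L - 2 * k) * inv_qfact q (int L + 2 * k))))"
    by (rule bailey_transfer[OF _ bailey_step_kernel[OF q] \<beta>_def]) simp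
  also have "\<dots> = (\<Sum>k\<in>{- int L..int L}. theta_term (q ^ 10) (q ^ 8) k *
        (inv_qfact q (int L - 2 * k) * inv_qfact q (int L + 2 * k)))"
  proof (intro sum.cong refl)
    fix k :: int
    have "2 * int (10 * tri k + 8 * tri (k - 1)) = 2 * int (4 * nat (k\<^sup>2) + 2 * tri k + nat ((2 * k)\<^sup>2))"
      using tri_eq[of k] tri_eq[of "k - 1"] by (simp add: algebra_simps power2_eq_square)
    then have "10 * tri k + 8 * tri (k - 1) = 4 * nat (k\<^sup>2) + 2 * tri k + nat ((2 * k)\<^sup>2)"
      unfolding mult_cancel_left of_nat_eq_iff by simp
    then have "q ^ (10 * tri k) * q ^ (8 * tri (k - 1)) =
        q ^ (4 * nat (k\<^sup>2)) * q ^ (2 * tri k) * q ^ nat ((2 * k)\<^sup>2)"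
      by (simp only: flip: power_add)
    then have "theta_term (q ^ 10) (q ^ 8) k = \<alpha> k * q ^ nat ((2 * k)\<^sup>2)"
      by (simp add: theta_term_def \<alpha>_def flip: power_mult)
    then show "\<alpha> k * (q ^ nat ((2 * k)\<^sup>2) * (inv_qfact q (int L - 2 * k) * inv_qfact q (int L + 2 * k))) =
        theta_term (q ^ 10) (q ^ 8) k * (inv_qfact q (int L - 2 * k) * inv_qfact q (int L + 2 * k))"
      by simp
  qed
  finally show ?thesis .
qed

section \<open>Limits\<close>

text \<open>Tannery's theorem for unordered sums over an arbitrary index set; it is applied to bilateral sums
  over the integers and to the double sum.\<close>
lemma has_sum_dominated_convergence:
  fixes f :: "nat \<Rightarrow> 'a \<Rightarrow> 'b::banach"
  assumes sum: "\<And>n. (f n has_sum S n) A"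
    and lim: "\<And>x. x \<in> A \<Longrightarrow> (\<lambda>n. f n x) \<longlonglongrightarrow> g x"
    and bound: "\<And>n x. x \<in> A \<Longrightarrow> norm (f n x) \<le> h x"
    and h: "h summable_on A"
  shows "g summable_on A" "S \<longlonglongrightarrow> infsum g A"
proof -
  have "norm (g x) \<le> h x" if "x \<in> A" for x
    using lim[OF that] bound[OF that] by (intro Lim_norm_ubound[of sequentially]) auto
  then show g: "g summable_on A"
    by (rule abs_summable_summable[OF Infinite_Sum.abs_summable_on_comparison_test'[OF h]])
  show "S \<longlonglongrightarrow> infsum g A"
  proof (rule swap_uniform_limit')
    show "\<forall>\<^sub>F X in finite_subsets_at_top A. (\<lambda>n. \<Sum>x\<in>X. f n x) \<longlonglongrightarrow> (\<Sum>x\<in>X. g x)"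
      by (intro eventually_finite_subsets_at_top_weakI tendsto_sum lim) auto
    show "(sum g \<longlongrightarrow> infsum g A) (finite_subsets_at_top A)"
      using has_sum_infsum[OF g] by (simp add: has_sum_def)
    show "uniform_limit UNIV (\<lambda>X n. \<Sum>x\<in>X. f n x) S (finite_subsets_at_top A)"
      by (rule Weierstrass_m_test_general'[OF bound sum h])
  qed auto
qed

lemma convergent_prod_qpoch:
  assumes "norm q < 1"
  shows "convergent_prod (\<lambda>j. 1 - x * q ^ j :: complex)"
proof -
  have "summable (\<lambda>j. norm x * norm q ^ j)"
    using assms by (intro summable_mult summable_geometric) auto
  then have "summable (\<lambda>j. norm ((1 - x * q ^ j) - 1))"
    by (simp add: norm_mult norm_power)
  then show ?thesis
    by (intro abs_convergent_prod_imp_convergent_prod summable_imp_abs_convergent_prod)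
qed

lemma qpoch_LIMSEQ:
  assumes "norm q < 1"
  shows "(\<lambda>n. qpoch x q n) \<longlonglongrightarrow> qpoch_inf x q"
  using convergent_prod_LIMSEQ[OF convergent_prod_qpoch[OF assms, of x]]
  unfolding qpoch_def qpoch_inf_def by (rule LIMSEQ_lessThan_iff_atMost[THEN iffD2])

lemma qpoch_inf_self_nonzero:
  assumes "norm q < 1"
  shows "qpoch_inf q q \<noteq> 0"
  unfolding qpoch_inf_def
proof (rule prodinf_nonzero[OF convergent_prod_qpoch[OF assms]])
  show "1 - q * q ^ j \<noteq> 0" for j
    using qpow_neq_1[OF assms, of "Suc j"] by simp
qed

lemma inverse_qpoch_bounded:
  assumes q: "norm q < 1" and x: "\<And>j. x * q ^ j \<noteq> 1"
  shows "\<exists>C>0. \<forall>n. norm (1 / qpoch x q n) \<le> C"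
proof -
  have "qpoch_inf x q \<noteq> 0"
    unfolding qpoch_inf_def using x
    by (intro prodinf_nonzero convergent_prod_qpoch q) (metis right_minus_eq)
  then have "(\<lambda>n. 1 / qpoch x q n) \<longlonglongrightarrow> 1 / qpoch_inf x q"
    by (intro tendsto_intros qpoch_LIMSEQ q)
  then have "Bseq (\<lambda>n. 1 / qpoch x q n)"
    by (intro convergent_imp_Bseq convergentI)
  then show ?thesis by (simp add: Bseq_def)
qed

lemma inv_qfact_bounded:
  assumes q: "norm q < 1"
  shows "\<exists>C>0. \<forall>m. norm (inv_qfact q m) \<le> C"
proof -
  have "q * q ^ j \<noteq> 1" for j using qpow_neq_1[OF q, of "Suc j"] by simp
  then obtain C where C: "C > 0" "\<And>n. norm (1 / qpoch q q n) \<le> C"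
    using inverse_qpoch_bounded[OF q] by blast
  have "norm (inv_qfact q m) \<le> C" for m
    using C by (simp add: inv_qfact_def)
  then show ?thesis using C by blast
qed

lemma inv_qfact_LIMSEQ:
  assumes q: "norm q < 1" and f: "filterlim f at_top sequentially"
  shows "(\<lambda>n. inv_qfact q (f n)) \<longlonglongrightarrow> 1 / qpoch_inf q q"
proof -
  have "filterlim (\<lambda>n. nat (f n)) at_top sequentially"
    by (rule filterlim_compose[OF filterlim_nat_sequentially f])
  then have "(\<lambda>n. qpoch q q (nat (f n))) \<longlonglongrightarrow> qpoch_inf q q"
    by (rule filterlim_compose[OF qpoch_LIMSEQ[OF q]])
  then have "(\<lambda>n. 1 / qpoch q q (nat (f n))) \<longlonglongrightarrow> 1 / qpoch_inf q q"
    by (intro tendsto_intros qpoch_inf_self_nonzero q)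
  moreover have "eventually (\<lambda>n. f n \<ge> 0) sequentially"
    using f by (simp add: filterlim_at_top)
  then have "eventually (\<lambda>n. 1 / qpoch q q (nat (f n)) = inv_qfact q (f n)) sequentially"
    by eventually_elim (simp add: inv_qfact_def)
  ultimately show ?thesis by (rule Lim_transform_eventually)
qed

lemma filterlim_int_plus:
  "filterlim (\<lambda>n. int n + c) at_top sequentially"
  unfolding filterlim_at_top eventually_sequentially
proof
  show "\<exists>N. \<forall>n\<ge>N. Z \<le> int n + c" for Z
    by (rule exI[of _ "nat (Z - c)"]) auto
qed

lemma bilateral_sum_LIMSEQ:
  assumes q: "norm q < 1" and c: "c > 0" and w: "(\<lambda>k. norm (w k)) summable_on (UNIV :: int set)"
  shows "(\<lambda>L. \<Sum>k\<in>{- int L..int L}. w k * (inv_qfact q (int L - c * k) * inv_qfact q (int L + c * k)))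
           \<longlonglongrightarrow> infsum w UNIV / (qpoch_inf q q)\<^sup>2"
proof -
  define f where "f L k = w k * (inv_qfact q (int L - c * k) * inv_qfact q (int L + c * k))"
    for L :: nat and k
  define E where "E = qpoch_inf q q"
  obtain C where C: "C > 0" "\<And>m. norm (inv_qfact q m) \<le> C"
    using inv_qfact_bounded[OF q] by blast
  have "(\<lambda>L. \<Sum>k\<in>{- int L..int L}. f L k) \<longlonglongrightarrow> (\<Sum>\<^sub>\<infinity>k. w k * (1 / E * (1 / E)))"
  proof (rule has_sum_dominated_convergence)
    fix L
    show "(f L has_sum (\<Sum>k\<in>{- int L..int L}. f L k)) UNIV"
    proof (rule has_sum_finite_neutralI)
      fix k assume "k \<in> UNIV - {- int L..int L}"
      then have "int L < \<bar>k\<bar>" by auto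
      moreover have "1 * \<bar>k\<bar> \<le> c * \<bar>k\<bar>" using c by (intro mult_right_mono) auto
      ultimately have "int L < \<bar>c * k\<bar>" using c by (simp add: abs_mult)
      then show "f L k = 0" by (simp only: f_def inv_qfact_pair_eq_0 mult_zero_right)
    qed auto
  next
    fix k
    have "filterlim (\<lambda>L. int L - c * k) at_top sequentially"
      "filterlim (\<lambda>L. int L + c * k) at_top sequentially"
      using filterlim_int_plus[of "- (c * k)"] filterlim_int_plus[of "c * k"] by simp_all
    then show "(\<lambda>L. f L k) \<longlonglongrightarrow> w k * (1 / E * (1 / E))"
      unfolding f_def E_def by (intro tendsto_mult tendsto_const inv_qfact_LIMSEQ q)
  next
    fix L k
    show "norm (f L k) \<le> norm (w k) * (C * C)"
      unfolding f_def norm_mult using C by (intro mult_left_mono mult_mono) auto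
  next
    show "(\<lambda>k. norm (w k) * (C * C)) summable_on UNIV"
      using w by (rule summable_on_cmult_left)
  qed
  also have "(\<Sum>\<^sub>\<infinity>k. w k * (1 / E * (1 / E))) = infsum w UNIV * (1 / E * (1 / E))"
    by (rule infsum_cmult_left')
  also have "\<dots> = infsum w UNIV / E\<^sup>2"
    by (simp add: power2_eq_square)
  finally show ?thesis unfolding f_def E_def .
qed

text \<open>Both sides of the finite form converge; \<open>w\<close> supplies the majorant for the bilateral one. For
  the $a$, $b$ used here it follows from a geometric series.\<close>
lemma jacobi_triple_product:
  assumes Q: "norm (a * b) < 1" and w: "(\<lambda>k. norm (theta_term a b k)) summable_on UNIV"
  shows "infsum (theta_term a b) UNIV = qpoch_infs [a, b, a * b] (a * b)"
proof -
  define E where "E = qpoch_inf (a * b) (a * b)"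
  have E: "E \<noteq> 0" unfolding E_def by (rule qpoch_inf_self_nonzero[OF Q])
  have "filterlim (\<lambda>L. 2 * int L) at_top sequentially"
    by (rule filterlim_at_top_mono[OF filterlim_int_sequentially]) auto
  then have "(\<lambda>L. qpoch a (a * b) L * qpoch b (a * b) L * inv_qfact (a * b) (2 * int L))
      \<longlonglongrightarrow> qpoch_inf a (a * b) * qpoch_inf b (a * b) * (1 / E)"
    unfolding E_def by (intro tendsto_mult qpoch_LIMSEQ inv_qfact_LIMSEQ Q)
  moreover have "(\<lambda>L. qpoch a (a * b) L * qpoch b (a * b) L * inv_qfact (a * b) (2 * int L))
      \<longlonglongrightarrow> infsum (theta_term a b) UNIV / E\<^sup>2"
    using bilateral_sum_LIMSEQ[OF Q _ w, of 1] unfolding mult_1 finite_jacobi_triple[OF Q] E_def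
    by simp
  ultimately have "infsum (theta_term a b) UNIV / E\<^sup>2 = qpoch_inf a (a * b) * qpoch_inf b (a * b) * (1 / E)"
    by (rule LIMSEQ_unique[rotated])
  then have "infsum (theta_term a b) UNIV = qpoch_inf a (a * b) * qpoch_inf b (a * b) * E"
    using E by (simp add: divide_eq_eq power2_eq_square)
  then show ?thesis
    by (simp add: qpoch_infs_def E_def mult.assoc)
qed

section \<open>The double sum\<close>

lemma summable_on_power_nat_abs:
  fixes x :: real
  assumes "0 \<le> x" "x < 1"
  shows "(\<lambda>k::int. x ^ nat \<bar>k\<bar>) summable_on UNIV"
proof -
  have g: "(\<lambda>n. x ^ n) summable_on UNIV"
    using assms by (subst summable_on_UNIV_nonneg_real_iff) (simp_all add: summable_geometric)
  have "(\<lambda>k. x ^ nat \<bar>k\<bar>) summable_on range int"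
    using summable_on_reindex[of int UNIV "\<lambda>k. x ^ nat \<bar>k\<bar>"] g by (simp add: o_def)
  moreover have "(\<lambda>k. x ^ nat \<bar>k\<bar>) summable_on range (\<lambda>n. - int n)"
    using summable_on_reindex[of "\<lambda>n. - int n" UNIV "\<lambda>k. x ^ nat \<bar>k\<bar>"] g
    by (simp add: o_def inj_on_def)
  ultimately have "(\<lambda>k. x ^ nat \<bar>k\<bar>) summable_on (range int \<union> range (\<lambda>n. - int n))"
    by (rule summable_on_union)
  also have "range int \<union> range (\<lambda>n. - int n) = UNIV"
  proof -
    have "k \<in> range int \<union> range (\<lambda>n. - int n)" for k
      by (cases k rule: int_cases2) (blast intro: rangeI)+
    then show ?thesis by (intro UNIV_eq_I[symmetric])
  qed
  finally show ?thesis .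
qed

lemma summable_on_power_times_power:
  fixes x :: real
  assumes "0 \<le> x" "x < 1"
  shows "(\<lambda>(n, r). x ^ n * x ^ r) summable_on (UNIV :: (nat \<times> nat) set)"
proof -
  have g: "(\<lambda>n. x ^ n) summable_on UNIV"
    using assms by (subst summable_on_UNIV_nonneg_real_iff) (simp_all add: summable_geometric)
  have "(\<lambda>z. norm (case z of (n, r) \<Rightarrow> x ^ n * x ^ r))
      summable_on (Sigma (UNIV :: nat set) (\<lambda>_. UNIV :: nat set))"
    unfolding Infinite_Sum.abs_summable_on_Sigma_iff
    using g assms by (auto simp: infsum_cmult_right' abs_mult infsum_nonneg
        intro!: summable_on_cmult_right summable_on_cmult_left)
  then have "(\<lambda>(n, r). x ^ n * x ^ r)
      summable_on (Sigma (UNIV :: nat set) (\<lambda>_. UNIV :: nat set))"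
    by (rule abs_summable_summable)
  then show ?thesis by simp
qed

theorem mainTheorem8:
  fixes q :: complex
  assumes "norm q < 1"
  shows "((\<lambda>(n::nat, r::nat).
            q ^ (n\<^sup>2 + 2 * r\<^sup>2) / (qpoch q (q\<^sup>2) n * qpoch (q\<^sup>2) (q\<^sup>2) r)
              * inv_qfact q (int n - 2 * int r))
          has_sum (qpoch_infs [q ^ 8, q ^ 10, q ^ 18] (q ^ 18) / qpoch_inf q q)) UNIV"
proof -
  note q = assms
  define x where "x = norm q"
  have x: "0 \<le> x" "x < 1" using q by (auto simp: x_def)
  define E where "E = qpoch_inf q q"
  have E: "E \<noteq> 0" unfolding E_def by (rule qpoch_inf_self_nonzero[OF q])
  define t where "t = (\<lambda>(n::nat, r::nat).
            q ^ (n\<^sup>2 + 2 * r\<^sup>2) / (qpoch q (q\<^sup>2) n * qpoch (q\<^sup>2) (q\<^sup>2) r)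
              * inv_qfact q (int n - 2 * int r))"
  define S where "S L = (\<Sum>n\<le>L. \<Sum>r\<le>n. t (n, r) * inv_qfact q (int L - int n))" for L
  define \<theta> where "\<theta> = theta_term (q ^ 10) (q ^ 8)"

  have ab: "q ^ 10 * q ^ 8 = q ^ 18" by (simp flip: power_add)
  \<comment> \<open>Here the theta terms are $\pm q^{9k^2+k}$, and $|k| \le 9k^2+k$ gives a geometric majorant.\<close>
  have \<theta>: "(\<lambda>k. norm (\<theta> k)) summable_on UNIV"
  proof (rule Infinite_Sum.abs_summable_on_comparison_test'[OF summable_on_power_nat_abs[OF x]])
    fix k :: int
    have "2 * int (10 * tri k + 8 * tri (k - 1)) = 2 * (9 * k\<^sup>2 + k)"
      using tri_eq[of k] tri_eq[of "k - 1"] by (simp add: algebra_simps power2_eq_square)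
    then have "int (10 * tri k + 8 * tri (k - 1)) = 9 * k\<^sup>2 + k" by simp
    moreover have "\<bar>k\<bar> \<le> 9 * k\<^sup>2 + k"
    proof -
      have "\<bar>k\<bar> \<le> k\<^sup>2"
        using mult_right_mono[of 1 "\<bar>k\<bar>" "\<bar>k\<bar>"]
        by (cases "k = 0") (simp_all add: power2_eq_square)
      then show ?thesis by linarith
    qed
    ultimately have e: "nat \<bar>k\<bar> \<le> 10 * tri k + 8 * tri (k - 1)" by linarith
    have "norm (\<theta> k) = x ^ (10 * tri k + 8 * tri (k - 1))"
      by (simp add: \<theta>_def theta_term_def norm_mult norm_power x_def power_add power_mult)
    also have "\<dots> \<le> x ^ nat \<bar>k\<bar>" using e x by (intro power_decreasing) auto
    finally show "norm (\<theta> k) \<le> x ^ nat \<bar>k\<bar>" .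
  qed
  have S_lim: "S \<longlonglongrightarrow> infsum \<theta> UNIV / E\<^sup>2"
    using bilateral_sum_LIMSEQ[OF q _ \<theta>, of 2] truncated_double_sum[OF q]
    by (simp add: S_def[abs_def] t_def E_def \<theta>_def)

  obtain C where C: "C > 0" "\<And>m. norm (inv_qfact q m) \<le> C"
    using inv_qfact_bounded[OF q] by blast
  have p: "norm (q\<^sup>2) < 1" using norm_power_lt_1[OF q, of 2] by simp
  have "q * (q\<^sup>2) ^ j \<noteq> 1" for j
    using qpow_neq_1[OF q, of "Suc (2 * j)"] by (simp add: power_mult)
  then obtain C1 where C1: "C1 > 0" "\<And>n. norm (1 / qpoch q (q\<^sup>2) n) \<le> C1"
    using inverse_qpoch_bounded[OF p] by blast
  have "q\<^sup>2 * (q\<^sup>2) ^ j \<noteq> 1" for j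
    using qpow_neq_1[OF p, of "Suc j"] by simp
  then obtain C2 where C2: "C2 > 0" "\<And>n. norm (1 / qpoch (q\<^sup>2) (q\<^sup>2) n) \<le> C2"
    using inverse_qpoch_bounded[OF p] by blast

  define f where "f L = (\<lambda>(n, r). t (n, r) * inv_qfact q (int L - int n))" for L
  define h where "h = (\<lambda>(n::nat, r::nat). (x ^ n * x ^ r) * (C1 * C2 * C * C))"
  have "(f L has_sum S L) UNIV" for L
  proof (rule has_sum_finite_neutralI)
    show "S L = (\<Sum>z\<in>(SIGMA n:{..L}. {..n}). f L z)"
      unfolding S_def f_def by (subst sum.Sigma) (auto simp: case_prod_unfold)
    fix z assume "z \<in> UNIV - (SIGMA n:{..L}. {..n})"
    then show "f L z = 0" by (cases z) (auto simp: f_def t_def)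
  qed auto
  moreover have "(\<lambda>L. f L z) \<longlonglongrightarrow> t z * (1 / E)" for z
  proof (cases z)
    case (Pair n r)
    have "filterlim (\<lambda>L. int L - int n) at_top sequentially"
      using filterlim_int_plus[of "- int n"] by simp
    then show ?thesis
      unfolding Pair f_def E_def prod.case by (intro tendsto_mult tendsto_const inv_qfact_LIMSEQ q)
  qed
  moreover have "norm (f L z) \<le> h z" for L z
  proof (cases z)
    case (Pair n r)
    have "n \<le> n\<^sup>2" "r \<le> r\<^sup>2" by (simp_all add: power2_eq_square)
    then have "n + r \<le> n\<^sup>2 + 2 * r\<^sup>2" by linarith
    then have "x ^ (n\<^sup>2 + 2 * r\<^sup>2) \<le> x ^ (n + r)" using x by (intro power_decreasing) auto
    then have xp: "norm (q ^ (n\<^sup>2 + 2 * r\<^sup>2)) \<le> x ^ n * x ^ r"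
      unfolding norm_power x_def[symmetric] by (simp only: power_add[of x n r])
    have "f L z = q ^ (n\<^sup>2 + 2 * r\<^sup>2) * (1 / qpoch q (q\<^sup>2) n * (1 / qpoch (q\<^sup>2) (q\<^sup>2) r)
        * inv_qfact q (int n - 2 * int r) * inv_qfact q (int L - int n))"
      by (simp add: Pair f_def t_def)
    also have "norm \<dots> \<le> (x ^ n * x ^ r) * (C1 * C2 * C * C)"
      unfolding norm_mult[of "q ^ _"] norm_mult[of _ "inv_qfact _ _"] norm_mult[of "1 / _"]
      using C C1(1) C2(1) x
      by (intro mult_mono xp C C1 C2) (auto intro!: mult_nonneg_nonneg)
    finally show ?thesis by (simp add: h_def Pair)
  qed
  moreover have "h summable_on UNIV"
    using summable_on_cmult_left[OF summable_on_power_times_power[OF x], of "C1 * C2 * C * C"]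
    by (simp add: h_def case_prod_unfold)
  ultimately have g: "(\<lambda>z. t z * (1 / E)) summable_on UNIV" "S \<longlonglongrightarrow> (\<Sum>\<^sub>\<infinity>z. t z * (1 / E))"
    by (rule has_sum_dominated_convergence)+
  have "((\<lambda>z. t z * (1 / E)) has_sum infsum \<theta> UNIV / E\<^sup>2) UNIV"
    using has_sum_infsum[OF g(1)] LIMSEQ_unique[OF g(2) S_lim] by simp
  then have "((\<lambda>z. t z * (1 / E) * E) has_sum infsum \<theta> UNIV / E\<^sup>2 * E) UNIV"
    by (rule has_sum_cmult_left)
  then have "(t has_sum infsum \<theta> UNIV / E) UNIV"
    using E by (simp add: power2_eq_square)
  moreover have "infsum \<theta> UNIV = qpoch_infs [q ^ 8, q ^ 10, q ^ 18] (q ^ 18)"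
  proof -
    have "norm (q ^ 10 * q ^ 8) < 1"
      unfolding ab using norm_power_lt_1[OF q, of 18] by simp
    from jacobi_triple_product[OF this \<theta>[unfolded \<theta>_def]] show ?thesis
      by (simp add: \<theta>_def ab qpoch_infs_def mult_ac)
  qed
  ultimately show ?thesis by (simp add: t_def E_def)
qed

end
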